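(* Let $G$ be a finite group such that $|G|$ has exactly four distinct prime divisors. Then the coprime graph $\Gamma(G)$ is a divisor graph if and only if the four elements of $\pi(G)$ can be labelled $p,q,r,s$ in such a way that $$\{p,q,r,s\}\subseteq V(\mathcal{N}_G)\subseteq\{p,q,r,s,pq,pr,rs\}.$$
   Context: $\pi(G)$ is the set of prime divisors of $|G|$. The coprime graph $\Gamma(G)$ is the simple undirected graph with vertex set $G$ in which two distinct vertices $x,y$ are adjacent if and only if $\gcd(o(x),o(y))=1$, where $o(x)$ is the order of $x$. For $a\in G$, $\pi(a)$ is the set of prime divisors of $o(a)$. The graph $\mathcal{N}_G$ has vertex set $V(\mathcal{N}_G)=\{\prod_{t\in\pi(a)}t: a\in G,\ a\neq e\}$, where $e$ is the identity of $G$, with distinct vertices $x,y$ adjacent if and only if $\gcd(x,y)=1$. A simple undirected graph $\Gamma$ is a divisor graph if there is an injection $\alpha$ from $V(\Gamma)$ to the set of positive integers such that distinct $x,y\in V(\Gamma)$ are adjacent if and only if $\alpha(x)\mid\alpha(y)$ or $\alpha(y)\mid\alpha(x)$. *)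

theory Defs
  imports
    "HOL-Algebra.Multiplicative_Group"
    "HOL-Computational_Algebra.Primes"
    "Graph_Theory.Pair_Digraph"
begin

text \<open>
  A simple undirected graph, with no finiteness requirement, is a
  \<^locale>\<open>pair_bidirected_digraph\<close>: its arcs are a symmetric, irreflexive relation on the
  vertices.  In the coprime graph the condition \<open>x \<noteq> y\<close> matters only for the identity,
  whose order is coprime to itself.
\<close>

definition coprime_graph :: "('a, 'b) monoid_scheme \<Rightarrow> 'a pair_pre_digraph" where
  "coprime_graph G =
     \<lparr> pverts = carrier G,
       parcs = {(x, y). x \<in> carrier G \<and> y \<in> carrier G \<and> x \<noteq> y \<and>
                  gcd (group.ord G x) (group.ord G y) = 1} \<rparr>"

definition element_primes :: "('a, 'b) monoid_scheme \<Rightarrow> 'a \<Rightarrow> nat set" where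
  "element_primes G a = prime_factors (group.ord G a)"

definition group_primes :: "('a, 'b) monoid_scheme \<Rightarrow> nat set" where
  "group_primes G = prime_factors (order G)"

text \<open>
  For a finite group neither \<^term>\<open>order G\<close> nor \<^term>\<open>group.ord G a\<close> is zero, so the sets of prime
  factors above are exactly the sets of prime divisors.
\<close>

definition N_graph :: "('a, 'b) monoid_scheme \<Rightarrow> nat pair_pre_digraph" where
  "N_graph G =
     (let V = {\<Prod>t\<in>element_primes G a. t | a. a \<in> carrier G \<and> a \<noteq> \<one>\<^bsub>G\<^esub>}
      in \<lparr> pverts = V, parcs = {(x, y). x \<in> V \<and> y \<in> V \<and> x \<noteq> y \<and> gcd x y = 1} \<rparr>)"

definition divisor_graph :: "'a pair_pre_digraph \<Rightarrow> bool" where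
  "divisor_graph \<Gamma> \<longleftrightarrow>
     pair_bidirected_digraph \<Gamma> \<and>
     (\<exists>\<alpha> :: 'a \<Rightarrow> nat. inj_on \<alpha> (pverts \<Gamma>) \<and> (\<forall>x\<in>pverts \<Gamma>. \<alpha> x > 0) \<and>
        (\<forall>x\<in>pverts \<Gamma>. \<forall>y\<in>pverts \<Gamma>. x \<noteq> y \<longrightarrow>
           ((x, y) \<in> parcs \<Gamma> \<longleftrightarrow> \<alpha> x dvd \<alpha> y \<or> \<alpha> y dvd \<alpha> x)))"

lemma pair_bidirected_digraph_coprime_graph: "pair_bidirected_digraph (coprime_graph G)"
  unfolding coprime_graph_def
  by unfold_locales
     (auto simp: symmetric_def sym_def arcs_ends_def arc_to_ends_def image_def gcd.commute)

lemma pair_bidirected_digraph_N_graph: "pair_bidirected_digraph (N_graph G)"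
  unfolding N_graph_def Let_def
  by unfold_locales
     (auto simp: symmetric_def sym_def arcs_ends_def arc_to_ends_def image_def gcd.commute)

end

theory Submission
  imports Defs "HOL-Algebra.Sylow"
begin

text \<open>
  The coprime graph only sees the sets \<open>\<pi>(x)\<close> of primes: distinct \<open>x\<close> and \<open>y\<close> are adjacent if and
  only if \<open>\<pi>(x)\<close> and \<open>\<pi>(y)\<close> are disjoint. For every finite group, whatever the number of
  primes, it is a divisor graph if and only if \<open>\<pi>(G)\<close> can be written as a list in which any two
  primes dividing the order of a common element are neighbours. In particular no element order
  may then have three prime divisors.

  Suppose that \<open>\<alpha>\<close> is a divisor labelling. By Cauchy's theorem there is an element of each prime
  order \<open>p\<close>; these elements are pairwise adjacent, so their labels form a chain under divisibility,
  and the chain lists the primes. Let \<open>c\<close> lie strictly between \<open>a\<close> and \<open>b\<close>, and suppose that some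
  element has order \<open>a * b\<close>. It is adjacent to the element of order \<open>c\<close>, so its label divides, or is
  a multiple of, the label belonging to \<open>c\<close>. By transitivity it is then comparable with the label
  belonging to \<open>b\<close> or to \<open>a\<close>, although the elements are not adjacent
  (\<open>divisor_graph_imp_consecutive\<close>).

  Conversely, given such a list, the sets \<open>\<pi>(x)\<close> with \<open>x\<close> not the identity are intervals in it, and
  disjoint intervals are ordered from left to right. With the identity put below everything else,
  adjacency becomes comparability in a finite strict order (\<open>consecutive_imp_divisor_graph\<close>), and
  every such order is realised by divisibility (\<open>finite_strict_order_divisor_labelling\<close>).

  For four primes listed as \<open>q, p, r, s\<close>, the admissible sets are the singletons and the neighbouring
  pairs \<open>{p, q}\<close>, \<open>{p, r}\<close>, \<open>{r, s}\<close>; taking products turns this into the condition on the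
  vertices of \<open>N_graph G\<close>.
\<close>

section \<open>Divisor labellings of finite strict orders\<close>

text \<open>
  Attach a private prime to every point, and label each point by the product of the primes of its
  principal down-set. Products of distinct primes divide one another exactly when the sets of
  primes are included, and inclusion of principal down-sets is the order itself.
\<close>
lemma finite_strict_order_divisor_labelling:
  assumes fin: "finite V"
    and irrefl: "irreflp_on V R"
    and trans: "transp_on V R"
  obtains \<alpha> :: "'a \<Rightarrow> nat"
  where "inj_on \<alpha> V" and "\<And>x. x \<in> V \<Longrightarrow> \<alpha> x > 0"
    and "\<And>x y. \<lbrakk>x \<in> V; y \<in> V\<rbrakk> \<Longrightarrow> \<alpha> x dvd \<alpha> y \<longleftrightarrow> x = y \<or> R x y"
proof -
  obtain B :: "nat set" where B: "B \<subseteq> {p. prime p}" "finite B" "card B = card V"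
    using infinite_arbitrarily_large[OF primes_infinite] by metis
  then obtain e where e: "bij_betw e V B"
    using fin finite_same_card_bij by metis
  have e_prime: "prime (e x)" if "x \<in> V" for x
    using e B that by (auto simp: bij_betw_def)
  have e_inj: "inj_on e V" using e by (simp add: bij_betw_def)
  define down where "down x = {y \<in> V. y = x \<or> R y x}" for x
  define \<alpha> where "\<alpha> x = prod e (down x)" for x
  have down_fin: "finite (down x)" for x
    using fin by (simp add: down_def)
  have dvd_iff: "\<alpha> x dvd \<alpha> y \<longleftrightarrow> x = y \<or> R x y" if xy: "x \<in> V" "y \<in> V" for x y
  proof
    assume dvd: "\<alpha> x dvd \<alpha> y"
    have "e x dvd \<alpha> x"
      unfolding \<alpha>_def using down_fin xy by (intro dvd_prodI) (auto simp: down_def)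
    then have "e x dvd prod e (down y)"
      using dvd \<alpha>_def dvd_trans by metis
    then obtain z where z: "z \<in> down y" "e x dvd e z"
      using prime_dvd_prod_iff[OF down_fin e_prime[OF xy(1)]] by blast
    then have "z \<in> V" by (simp add: down_def)
    then have "e x = e z"
      using primes_dvd_imp_eq[OF e_prime e_prime z(2)] xy by blast
    then have "x = z"
      using e_inj xy z by (auto simp: down_def inj_on_def)
    then show "x = y \<or> R x y"
      using z by (simp add: down_def)
  next
    assume "x = y \<or> R x y"
    then have "down x \<subseteq> down y"
    proof
      assume "R x y"
      then show ?thesis
        unfolding down_def using transp_onD[OF trans _ xy] xy by blast
    qed simp
    then show "\<alpha> x dvd \<alpha> y"
      unfolding \<alpha>_def by (rule prod_dvd_prod_subset[OF down_fin])
  qed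
  have "inj_on \<alpha> V"
  proof (rule inj_onI)
    fix x y assume xy: "x \<in> V" "y \<in> V" "\<alpha> x = \<alpha> y"
    then have "x = y \<or> R x y" "y = x \<or> R y x"
      using dvd_iff by (metis dvd_refl)+
    then show "x = y"
      using transp_onD[OF trans] irreflp_onD[OF irrefl] xy by blast
  qed
  moreover have "\<alpha> x > 0" if "x \<in> V" for x
    unfolding \<alpha>_def by (intro prod_pos) (auto simp: down_def intro: prime_gt_0_nat e_prime)
  ultimately show thesis
    using dvd_iff that by blast
qed

section \<open>Orders of elements of a finite group\<close>

text \<open>
  Cauchy's theorem: Sylow's theorem, applied with exponent one, yields a subgroup of order \<open>p\<close>, in
  which every element other than the identity has order \<open>p\<close>.
\<close>
lemma (in group) cauchy_prime_order:
  assumes fin: "finite (carrier G)" and p: "prime p" "p dvd order G"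
  obtains x where "x \<in> carrier G" "ord x = p"
proof -
  obtain m where "order G = p ^ 1 * m" using p by auto
  then obtain H where H: "subgroup H G" "card H = p"
    using sylow_thm[OF p(1) is_group _ fin, of 1] by auto
  then interpret H: group "G\<lparr>carrier := H\<rparr>"
    by (simp add: subgroup.subgroup_is_group)
  have "card H > 1" using H p prime_gt_1_nat by simp
  then have "\<not> H \<subseteq> {\<one>}"
    using card_mono[of "{\<one>}" H] by auto
  then obtain x where x: "x \<in> H" "x \<noteq> \<one>" by auto
  then have xG: "x \<in> carrier G" using H subgroup.subset by blast
  have "x [^] p = \<one>"
    using H.pow_order_eq_1[of x] x H by (simp add: order_def nat_pow_consistent[symmetric])
  then have "ord x dvd p" using pow_eq_id xG by simp
  moreover have "ord x \<noteq> 1" using ord_eq_1 xG x by simp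
  ultimately have "ord x = p" using p by (meson prime_nat_iff)
  then show thesis using that xG by blast
qed

lemma (in group) exists_ord_eq_divisor:
  assumes fin: "finite (carrier G)" and x: "x \<in> carrier G" and d: "d dvd ord x"
  obtains y where "y \<in> carrier G" "ord y = d"
proof -
  have pos: "ord x \<noteq> 0" using ord_ge_1[OF fin x] by simp
  obtain k where k: "ord x = d * k" using d by blast
  then have "ord (x [^] k) = d"
    using ord_pow[OF x, of k] pos by simp
  then show thesis using that x by blast
qed

lemma (in group) element_primes_iff:
  assumes "finite (carrier G)" "x \<in> carrier G"
  shows "p \<in> element_primes G x \<longleftrightarrow> prime p \<and> p dvd ord x"
  using ord_ge_1[OF assms] by (auto simp: element_primes_def in_prime_factors_iff)

lemma (in group) group_primes_iff:
  assumes "finite (carrier G)"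
  shows "p \<in> group_primes G \<longleftrightarrow> prime p \<and> p dvd order G"
  using assms order_gt_0_iff_finite by (auto simp: group_primes_def in_prime_factors_iff)

lemma (in group) element_primes_subset:
  assumes "finite (carrier G)" "x \<in> carrier G"
  shows "element_primes G x \<subseteq> group_primes G"
  using assms element_primes_iff group_primes_iff ord_dvd_group_order dvd_trans by blast

lemma (in group) element_primes_empty_iff:
  assumes "finite (carrier G)" "x \<in> carrier G"
  shows "element_primes G x = {} \<longleftrightarrow> x = \<one>"
proof -
  have "element_primes G x = {} \<longleftrightarrow> ord x = 1"
    using element_primes_iff[OF assms] prime_factor_nat[of "ord x"] by auto
  then show ?thesis using ord_eq_1 assms by blast
qed

lemma pverts_coprime_graph: "pverts (coprime_graph G) = carrier G"
  by (simp add: coprime_graph_def)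

lemma (in group) coprime_graph_adj_iff:
  assumes fin: "finite (carrier G)" and xy: "x \<in> carrier G" "y \<in> carrier G" "x \<noteq> y"
  shows "(x, y) \<in> parcs (coprime_graph G) \<longleftrightarrow> element_primes G x \<inter> element_primes G y = {}"
proof -
  have "gcd (ord x) (ord y) = 1 \<longleftrightarrow> \<not> (\<exists>p. prime p \<and> p dvd ord x \<and> p dvd ord y)"
    using prime_factor_nat[of "gcd (ord x) (ord y)"]
    by (metis gcd_greatest gcd_dvd1 gcd_dvd2 dvd_trans not_prime_unit)
  then show ?thesis
    using xy element_primes_iff[OF fin] by (auto simp: coprime_graph_def)
qed

section \<open>Linear arrangements of the primes\<close>

definition pairwise_consecutive :: "'c list \<Rightarrow> 'c set \<Rightarrow> bool" where
  "pairwise_consecutive L A \<longleftrightarrow>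
     (\<forall>i j. i < j \<longrightarrow> j < length L \<longrightarrow> L ! i \<in> A \<longrightarrow> L ! j \<in> A \<longrightarrow> j = Suc i)"

definition entirely_before :: "'c list \<Rightarrow> 'c set \<Rightarrow> 'c set \<Rightarrow> bool" where
  "entirely_before L A B \<longleftrightarrow>
     (\<forall>i j. i < length L \<longrightarrow> j < length L \<longrightarrow> L ! i \<in> A \<longrightarrow> L ! j \<in> B \<longrightarrow> i < j)"

text \<open>
  Sets of pairwise consecutive entries occupy at most two neighbouring positions, so they are
  intervals, and disjoint intervals on a line are comparable. If the claim failed, the positions
  of \<open>A\<close> and \<open>B\<close> would interleave, and so little room would force a common position.
\<close>
lemma disjoint_consecutive_comparable:
  assumes A: "pairwise_consecutive L A" and B: "pairwise_consecutive L B"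
    and disj: "A \<inter> B = {}"
  shows "entirely_before L A B \<or> entirely_before L B A"
proof (rule ccontr)
  assume "\<not> ?thesis"
  then obtain i j i' j' where
    ij: "i < length L" "j < length L" "L ! i \<in> A" "L ! j \<in> B" "\<not> i < j" and
    ij': "i' < length L" "j' < length L" "L ! j' \<in> B" "L ! i' \<in> A" "\<not> j' < i'"
    unfolding entirely_before_def by blast
  have "i \<noteq> j" "i' \<noteq> j'" "i' \<noteq> j" "i \<noteq> j'" using ij ij' disj by blast+
  moreover have "i \<le> Suc i'"
    using A ij ij' unfolding pairwise_consecutive_def by (metis le_Suc_eq not_less order_refl)
  moreover have "j' \<le> Suc j"
    using B ij ij' unfolding pairwise_consecutive_def by (metis le_Suc_eq not_less order_refl)
  ultimately show False using ij ij' by linarith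
qed

text \<open>
  A divisor labelling forbids a prime between two primes of a common element order: the label of an
  element of order \<open>a * b\<close> is comparable with the label belonging to any third prime \<open>c\<close>, but with
  neither of those belonging to \<open>a\<close> and \<open>b\<close>, so \<open>c\<close> lies on the same side of \<open>a\<close> and \<open>b\<close>.
\<close>
lemma (in group) divisor_graph_imp_consecutive:
  assumes fin: "finite (carrier G)" and dg: "divisor_graph (coprime_graph G)"
  obtains L where "distinct L" "set L = group_primes G"
    "\<And>x. x \<in> carrier G \<Longrightarrow> pairwise_consecutive L (element_primes G x)"
proof -
  obtain \<alpha> :: "'a \<Rightarrow> nat" where pos: "\<And>x. x \<in> carrier G \<Longrightarrow> \<alpha> x > 0"
    and adj: "\<And>x y. \<lbrakk>x \<in> carrier G; y \<in> carrier G; x \<noteq> y\<rbrakk> \<Longrightarrow>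
      \<alpha> x dvd \<alpha> y \<or> \<alpha> y dvd \<alpha> x \<longleftrightarrow> element_primes G x \<inter> element_primes G y = {}"
    using dg coprime_graph_adj_iff[OF fin] unfolding divisor_graph_def pverts_coprime_graph
    by metis
  have "\<exists>x. x \<in> carrier G \<and> ord x = p" if "p \<in> group_primes G" for p
    using that cauchy_prime_order[OF fin] group_primes_iff[OF fin] by metis
  then obtain g where g: "\<And>p. p \<in> group_primes G \<Longrightarrow> g p \<in> carrier G"
    "\<And>p. p \<in> group_primes G \<Longrightarrow> ord (g p) = p"
    by metis
  have g_primes: "element_primes G (g p) = {p}" if "p \<in> group_primes G" for p
    using that g group_primes_iff[OF fin] by (simp add: element_primes_def prime_prime_factors)
  obtain xs where xs: "set xs = group_primes G" "distinct xs"
    using finite_distinct_list[of "group_primes G"] by (auto simp: group_primes_def)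
  \<comment> \<open>The labels of the prime-order elements are pairwise comparable for divisibility, so sorting
    them by size arranges them in the divisibility chain.\<close>
  define L where "L = sort_key (\<alpha> \<circ> g) xs"
  have L: "distinct L" "set L = group_primes G"
    using xs by (simp_all add: L_def)
  have chain: "\<alpha> (g (L ! i)) dvd \<alpha> (g (L ! j))" if "i < j" "j < length L" for i j
  proof -
    have in_P: "L ! i \<in> group_primes G" "L ! j \<in> group_primes G"
      using that L(2) nth_mem[of i L] nth_mem[of j L] by auto
    have neq: "L ! i \<noteq> L ! j"
      using that L(1) by (simp add: nth_eq_iff_index_eq)
    then have "g (L ! i) \<noteq> g (L ! j)" using g in_P by metis
    then have "\<alpha> (g (L ! i)) dvd \<alpha> (g (L ! j)) \<or> \<alpha> (g (L ! j)) dvd \<alpha> (g (L ! i))"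
      using adj g_primes g in_P neq by simp
    moreover have "\<alpha> (g (L ! i)) \<le> \<alpha> (g (L ! j))"
      using sorted_nth_mono[of "map (\<alpha> \<circ> g) L" i j] that by (simp add: L_def)
    ultimately show ?thesis
      using pos g in_P dvd_imp_le by (metis dvd_refl le_antisym)
  qed
  have "pairwise_consecutive L (element_primes G x)" if x: "x \<in> carrier G" for x
    unfolding pairwise_consecutive_def
  proof (intro allI impI, rule ccontr)
    fix i j
    assume ij: "i < j" "j < length L" "L ! i \<in> element_primes G x" "L ! j \<in> element_primes G x"
      and "j \<noteq> Suc i"
    define k where "k = Suc i"
    have k: "i < k" "k < j" using ij \<open>j \<noteq> Suc i\<close> by (simp_all add: k_def)
    define a b c where "a = L ! i" and "b = L ! j" and "c = L ! k"
    have abc: "a \<noteq> b" "a \<noteq> c" "b \<noteq> c"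
      using L(1) ij k by (simp_all add: a_def b_def c_def nth_eq_iff_index_eq)
    have P: "a \<in> group_primes G" "b \<in> group_primes G" "c \<in> group_primes G"
      using L(2) ij k nth_mem[of _ L] by (auto simp: a_def b_def c_def)
    have prime: "prime a" "prime b" "a dvd ord x" "b dvd ord x"
      using ij element_primes_iff[OF fin x] by (simp_all add: a_def b_def)
    \<comment> \<open>The order of \<open>x\<close> may be divisible by \<open>c\<close> as well, so pass to a power of \<open>x\<close> whose order
      is exactly \<open>a * b\<close>.\<close>
    then have "a * b dvd ord x"
      using abc by (simp add: divides_mult primes_coprime)
    then obtain h where h: "h \<in> carrier G" "ord h = a * b"
      using exists_ord_eq_divisor[OF fin x] by blast
    have h_primes: "element_primes G h = {a, b}"
      using prime h prime_gt_0_nat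
      by (auto simp: element_primes_def prime_factors_product prime_prime_factors)
    have "h \<noteq> g a" "h \<noteq> g b" "h \<noteq> g c"
      using h_primes g_primes P abc by (metis doubleton_eq_iff insert_absorb2)+
    then have h_adj: "\<alpha> h dvd \<alpha> (g c) \<or> \<alpha> (g c) dvd \<alpha> h"
      "\<not> \<alpha> h dvd \<alpha> (g b)" "\<not> \<alpha> (g a) dvd \<alpha> h"
      using adj[of h "g a"] adj[of h "g b"] adj[of h "g c"] h(1) g(1) P h_primes g_primes abc
      by simp_all
    have "\<alpha> (g a) dvd \<alpha> (g c)" "\<alpha> (g c) dvd \<alpha> (g b)"
      using chain k ij by (simp_all add: a_def b_def c_def)
    with h_adj show False using dvd_trans by blast
  qed
  with L show thesis using that by blast
qed

text \<open>
  The order to be labelled compares the prime sets from left to right along \<open>L\<close>. The identity needs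
  a place of its own: its prime set is empty, hence entirely before and entirely after every other
  set, so it is declared to be the least element.
\<close>
lemma (in group) consecutive_imp_divisor_graph:
  assumes fin: "finite (carrier G)" and L: "set L = group_primes G"
    and cons: "\<And>x. x \<in> carrier G \<Longrightarrow> pairwise_consecutive L (element_primes G x)"
  shows "divisor_graph (coprime_graph G)"
proof -
  define R where "R x y \<longleftrightarrow> x \<noteq> y \<and> (x = \<one> \<or> y \<noteq> \<one> \<and>
      entirely_before L (element_primes G x) (element_primes G y))" for x y
  have index: "\<exists>i < length L. L ! i \<in> element_primes G x" if "x \<in> carrier G" "x \<noteq> \<one>" for x
  proof -
    have "element_primes G x \<noteq> {}"
      using that element_primes_empty_iff[OF fin] by simp
    then obtain p where p: "p \<in> element_primes G x" by blast
    then have "p \<in> set L"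
      using element_primes_subset[OF fin that(1)] L by blast
    then obtain i where "i < length L" "L ! i = p"
      by (auto simp: in_set_conv_nth)
    with p show ?thesis by blast
  qed
  have before_trans: "entirely_before L (element_primes G x) (element_primes G z)"
    if y: "y \<in> carrier G" "y \<noteq> \<one>" and "entirely_before L (element_primes G x) (element_primes G y)"
      "entirely_before L (element_primes G y) (element_primes G z)" for x y z
    unfolding entirely_before_def
  proof (intro allI impI)
    fix i k
    assume ik: "i < length L" "k < length L" "L ! i \<in> element_primes G x" "L ! k \<in> element_primes G z"
    obtain j where "j < length L" "L ! j \<in> element_primes G y"
      using index[OF y] by blast
    then have "i < j" "j < k" using that(3,4) ik unfolding entirely_before_def by blast+
    then show "i < k" by simp
  qed
  have before_irrefl: "\<not> entirely_before L (element_primes G x) (element_primes G x)"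
    if "x \<in> carrier G" "x \<noteq> \<one>" for x
    using index[OF that] unfolding entirely_before_def by blast
  have "irreflp_on (carrier G) R"
    by (rule irreflp_onI) (simp add: R_def)
  moreover have "transp_on (carrier G) R"
  proof (rule transp_onI)
    fix x y z
    assume xyz: "x \<in> carrier G" "y \<in> carrier G" "z \<in> carrier G" "R x y" "R y z"
    show "R x z"
    proof (cases "x = \<one>")
      case False
      then have "y \<noteq> \<one>" "z \<noteq> \<one>" "entirely_before L (element_primes G x) (element_primes G z)"
        using xyz before_trans[of y x z] by (auto simp: R_def)
      then show ?thesis
        using before_irrefl[OF xyz(1) False] by (auto simp: R_def)
    qed (use xyz in \<open>auto simp: R_def\<close>)
  qed
  ultimately obtain \<alpha> :: "'a \<Rightarrow> nat" where \<alpha>: "inj_on \<alpha> (carrier G)"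
    "\<And>x. x \<in> carrier G \<Longrightarrow> \<alpha> x > 0"
    "\<And>x y. \<lbrakk>x \<in> carrier G; y \<in> carrier G\<rbrakk> \<Longrightarrow> \<alpha> x dvd \<alpha> y \<longleftrightarrow> x = y \<or> R x y"
    using finite_strict_order_divisor_labelling[OF fin] by blast
  have adj_iff: "(x, y) \<in> parcs (coprime_graph G) \<longleftrightarrow> R x y \<or> R y x"
    if xy: "x \<in> carrier G" "y \<in> carrier G" "x \<noteq> y" for x y
  proof (cases "x = \<one> \<or> y = \<one>")
    case True
    then show ?thesis
      using xy coprime_graph_adj_iff[OF fin xy] element_primes_empty_iff[OF fin]
      by (auto simp: R_def)
  next
    case False
    have sub: "element_primes G x \<subseteq> set L"
      using xy L element_primes_subset[OF fin] by auto
    have "element_primes G x \<inter> element_primes G y = {} \<longleftrightarrow>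
      entirely_before L (element_primes G x) (element_primes G y) \<or>
      entirely_before L (element_primes G y) (element_primes G x)"
    proof
      assume "element_primes G x \<inter> element_primes G y = {}"
      then show "entirely_before L (element_primes G x) (element_primes G y) \<or>
          entirely_before L (element_primes G y) (element_primes G x)"
        using disjoint_consecutive_comparable[OF cons[OF xy(1)] cons[OF xy(2)]]
        unfolding entirely_before_def by blast
    next
      assume "entirely_before L (element_primes G x) (element_primes G y) \<or>
          entirely_before L (element_primes G y) (element_primes G x)"
      then show "element_primes G x \<inter> element_primes G y = {}"
        using sub unfolding entirely_before_def by (fastforce simp: in_set_conv_nth)
    qed
    then show ?thesis
      using False xy coprime_graph_adj_iff[OF fin xy] by (auto simp: R_def)
  qed
  from \<alpha> adj_iff show ?thesis
    unfolding divisor_graph_def pverts_coprime_graph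
    by (intro conjI pair_bidirected_digraph_coprime_graph exI[of _ \<alpha>]) auto
qed

section \<open>Four primes\<close>

text \<open>
  Only the three pairs that are not neighbours have to be excluded; every set of three primes
  contains one of them.
\<close>
lemma pairwise_consecutive_four_iff:
  assumes "distinct [q, p, r, s]" "A \<subseteq> {q, p, r, s}"
  shows "pairwise_consecutive [q, p, r, s] A \<longleftrightarrow>
    A \<in> {{}, {p}, {q}, {r}, {s}, {p, q}, {p, r}, {r, s}}"
proof -
  have "pairwise_consecutive [q, p, r, s] A \<longleftrightarrow>
    \<not> (q \<in> A \<and> r \<in> A) \<and> \<not> (q \<in> A \<and> s \<in> A) \<and> \<not> (p \<in> A \<and> s \<in> A)"
    (is "?cons \<longleftrightarrow> ?none")
  proof
    assume ?cons
    then have step: "\<And>i j. \<lbrakk>i < j; j < 4; [q, p, r, s] ! i \<in> A; [q, p, r, s] ! j \<in> A\<rbrakk> \<Longrightarrow> j = Suc i"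
      unfolding pairwise_consecutive_def by simp
    have "\<not> (q \<in> A \<and> r \<in> A)" using step[of 0 2] by auto
    moreover have "\<not> (q \<in> A \<and> s \<in> A)" using step[of 0 3] by auto
    moreover have "\<not> (p \<in> A \<and> s \<in> A)" using step[of 1 3] by auto
    ultimately show ?none by blast
  next
    assume ?none
    then show ?cons
      unfolding pairwise_consecutive_def by (auto simp: less_Suc_eq)
  qed
  also have "\<dots> \<longleftrightarrow> A \<in> {{}, {p}, {q}, {r}, {s}, {p, q}, {p, r}, {r, s}}"
  proof
    assume ?none
    then have "A \<in> Pow {p, q} \<union> Pow {p, r} \<union> Pow {r, s}"
      using assms(2) by blast
    then show "A \<in> {{}, {p}, {q}, {r}, {s}, {p, q}, {p, r}, {r, s}}"
      unfolding Pow_insert Pow_empty by fast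
  next
    assume "A \<in> {{}, {p}, {q}, {r}, {s}, {p, q}, {p, r}, {r, s}}"
    then show ?none using assms(1) by auto
  qed
  finally show ?thesis .
qed

text \<open>
  A vertex of \<open>N_graph G\<close> determines the set of primes from which it was formed.
\<close>
lemma prime_factors_Prod_primes:
  fixes A :: "nat set"
  assumes "finite A" "\<And>p. p \<in> A \<Longrightarrow> prime p"
  shows "prime_factors (\<Prod>A) = A"
proof -
  have "0 \<notin> id ` A" using assms(2)[of 0] by auto
  then have "prime_factors (\<Prod>A) = (\<Union>p\<in>A. prime_factors p)"
    using prime_factors_prod[OF assms(1), of id] by (simp add: comp_def)
  also have "\<dots> = A" using assms(2) by (simp add: prime_prime_factors)
  finally show ?thesis .
qed

theorem theorem5p6:
  fixes G :: "('a, 'b) monoid_scheme"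
  assumes "group G"
    and "finite (carrier G)"
    and "card (group_primes G) = 4"
  shows "divisor_graph (coprime_graph G) \<longleftrightarrow>
    (\<exists>p q r s. {p, q, r, s} = group_primes G \<and>
       {p, q, r, s} \<subseteq> pverts (N_graph G) \<and>
       pverts (N_graph G) \<subseteq> {p, q, r, s, p * q, p * r, r * s})"
proof -
  interpret group G by fact
  note fin = assms(2)
  have verts: "pverts (N_graph G) = {\<Prod>(element_primes G a) | a. a \<in> carrier G \<and> a \<noteq> \<one>\<^bsub>G\<^esub>}"
    by (simp add: N_graph_def Let_def)
  have recover: "prime_factors (\<Prod>(element_primes G a)) = element_primes G a"
    if "a \<in> carrier G" for a
    using that element_primes_iff[OF fin]
    by (intro prime_factors_Prod_primes) (auto simp: element_primes_def)
  have primes_in: "group_primes G \<subseteq> pverts (N_graph G)"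
  proof
    fix p assume "p \<in> group_primes G"
    then have p: "prime p" "p dvd order G" using group_primes_iff[OF fin] by auto
    then obtain a where a: "a \<in> carrier G" "ord a = p"
      using cauchy_prime_order[OF fin] by blast
    then have ap: "element_primes G a = {p}"
      using p by (simp add: element_primes_def prime_prime_factors)
    moreover have "a \<noteq> \<one>\<^bsub>G\<^esub>" using ap element_primes_empty_iff[OF fin a(1)] by auto
    ultimately show "p \<in> pverts (N_graph G)"
      unfolding verts using a by (auto intro!: exI[of _ a])
  qed
  show ?thesis
  proof
    assume "divisor_graph (coprime_graph G)"
    then obtain L where L: "distinct L" "set L = group_primes G"
      and cons: "\<And>x. x \<in> carrier G \<Longrightarrow> pairwise_consecutive L (element_primes G x)"
      using divisor_graph_imp_consecutive[OF fin] by metis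
    have "length L = 4" using L assms(3) distinct_card by metis
    then obtain q p r s where L_eq: "L = [q, p, r, s]"
      by (auto simp: numeral_eq_Suc length_Suc_conv)
    have set_eq: "{p, q, r, s} = group_primes G" using L L_eq by auto
    have "\<Prod>(element_primes G a) \<in> {p, q, r, s, p * q, p * r, r * s}"
      if a: "a \<in> carrier G" "a \<noteq> \<one>\<^bsub>G\<^esub>" for a
    proof -
      have "element_primes G a \<in> {{p}, {q}, {r}, {s}, {p, q}, {p, r}, {r, s}}"
        using pairwise_consecutive_four_iff[of q p r s "element_primes G a"]
          element_primes_subset[OF fin a(1)] element_primes_empty_iff[OF fin a(1)]
          cons[OF a(1)] L L_eq a by auto
      then have "\<Prod>(element_primes G a) \<in> Prod ` {{p}, {q}, {r}, {s}, {p, q}, {p, r}, {r, s}}"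
        by (rule imageI)
      then show ?thesis using L(1) L_eq by simp
    qed
    then have "pverts (N_graph G) \<subseteq> {p, q, r, s, p * q, p * r, r * s}"
      unfolding verts by blast
    with set_eq primes_in show "\<exists>p q r s. {p, q, r, s} = group_primes G \<and>
       {p, q, r, s} \<subseteq> pverts (N_graph G) \<and>
       pverts (N_graph G) \<subseteq> {p, q, r, s, p * q, p * r, r * s}"
      by metis
  next
    assume "\<exists>p q r s. {p, q, r, s} = group_primes G \<and>
       {p, q, r, s} \<subseteq> pverts (N_graph G) \<and>
       pverts (N_graph G) \<subseteq> {p, q, r, s, p * q, p * r, r * s}"
    then obtain p q r s where set_eq: "{p, q, r, s} = group_primes G"
      and sub: "pverts (N_graph G) \<subseteq> {p, q, r, s, p * q, p * r, r * s}"
      by (elim exE conjE)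
    have dist: "distinct [q, p, r, s]"
    proof (rule card_distinct)
      have "set [q, p, r, s] = group_primes G" using set_eq by auto
      then show "card (set [q, p, r, s]) = length [q, p, r, s]" using assms(3) by simp
    qed
    have prime: "prime p" "prime q" "prime r" "prime s"
      using set_eq group_primes_iff[OF fin] by blast+
    have pos: "p \<noteq> 0" "q \<noteq> 0" "r \<noteq> 0" "s \<noteq> 0" using prime by auto
    have "pairwise_consecutive [q, p, r, s] (element_primes G a)" if a: "a \<in> carrier G" for a
    proof -
      have "element_primes G a \<in> {{}, {p}, {q}, {r}, {s}, {p, q}, {p, r}, {r, s}}"
      proof (cases "a = \<one>\<^bsub>G\<^esub>")
        case True
        then show ?thesis using element_primes_empty_iff[OF fin a] by simp
      next
        case False
        then have "\<Prod>(element_primes G a) \<in> {p, q, r, s, p * q, p * r, r * s}"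
          using sub a unfolding verts by blast
        then have "element_primes G a \<in> prime_factors ` {p, q, r, s, p * q, p * r, r * s}"
          using recover[OF a] by (metis imageI)
        then show ?thesis
          using pos prime by (simp add: prime_factors_product prime_prime_factors insert_commute)
      qed
      then show ?thesis
        using pairwise_consecutive_four_iff[OF dist] element_primes_subset[OF fin a] set_eq
        by auto
    qed
    moreover have "set [q, p, r, s] = group_primes G" using set_eq by auto
    ultimately show "divisor_graph (coprime_graph G)"
      using consecutive_imp_divisor_graph[OF fin] by metis
  qed
qed

end
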